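(* Let $n,m,T\ge 1$ be integers, let $A\in\mathbb{R}^{n\times n}$, $B\in\mathbb{R}^{n\times m}$ with $(A,B)$ controllable, and let $\{u(k)\}_{k=0}^{T-1}\subset\mathbb{R}^m$, $\{x(k)\}_{k=0}^{T}\subset\mathbb{R}^n$ satisfy $x(k+1)=Ax(k)+Bu(k)$ for $k=0,\dots,T-1$. Assume that $\{u(k)\}_{k=0}^{T-1}$ is persistently exciting of order $n+1$. Let $\delta\in\mathbb{R}$ satisfy $|\delta|\ge 2$, and let $\{\tilde x(k)\}_{k=0}^{T}$ be a poisoned state trajectory generated by the poisoned state trajectory generation algorithm (described in the context) from the dataset $(\{u(k)\}_{k=0}^{T-1},\{x(k)\}_{k=0}^{T})$ with parameter $\delta$. Then the attack is effective for destabilization; that is, for every $K\in\mathbb{R}^{m\times n}$ that stabilizes the open-loop system consistent with the poisoned dataset $(\{u(k)\}_{k=0}^{T-1},\{\tilde x(k)\}_{k=0}^{T})$, the matrix $A+BK$ is not Schur stable.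
   Context: Persistent excitation: a sequence $\{w(k)\}_{k=0}^{T-1}$, $w(k)\in\mathbb{R}^q$, is persistently exciting of order $L$ if its Hankel matrix of depth $L$, namely the $qL\times(T-L+1)$ real matrix whose $j$-th column ($j=0,\dots,T-L$) is the stacked vector $(w(j),w(j+1),\dots,w(j+L-1))$, has rank $qL$ (full row rank). Data matrices: $U=[u(0)\ u(1)\cdots u(T-1)]\in\mathbb{R}^{m\times T}$, $X_-=[x(0)\ x(1)\cdots x(T-1)]\in\mathbb{R}^{n\times T}$, $X_+=[x(1)\ x(2)\cdots x(T)]\in\mathbb{R}^{n\times T}$; similarly $\tilde X_-=[\tilde x(0)\cdots\tilde x(T-1)]$ and $\tilde X_+=[\tilde x(1)\cdots\tilde x(T)]$. Poisoned state trajectory generation algorithm (input: the dataset and $\delta\in\mathbb{R}$): set $\Delta(0)=0\in\mathbb{R}^n$ and $\tilde x(0)=x(0)$. For $k=0,\dots,T-1$: let $g(k)\in\mathbb{R}^T$ be a (i.e., any) solution of $$\begin{bmatrix}X_-\\ U\end{bmatrix}g(k)=\begin{bmatrix}\Delta(k)\\ 0\end{bmatrix},$$ set $\Delta(k+1)=X_+g(k)+\delta\,(x(k)+\Delta(k))$, and set $\tilde x(k+1)=x(k+1)+\Delta(k+1)$. The output is $\{\tilde x(k)\}_{k=0}^{T}$. System consistent with a dataset: the open-loop system consistent with $(\{u(k)\}_{k=0}^{T-1},\{\tilde x(k)\}_{k=0}^{T})$ is $x(k+1)=\tilde A x(k)+\tilde B u(k)$, where $(\tilde A,\tilde B)\in\mathbb{R}^{n\times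 n}\times\mathbb{R}^{n\times m}$ is the pair satisfying $\tilde X_+=\tilde A\tilde X_-+\tilde B U$ (in the setting considered, this pair exists and is unique). The matrix $K$ stabilizes this system if $\tilde A+\tilde B K$ is Schur stable. Schur stable: all (complex) eigenvalues of the matrix have modulus strictly less than $1$. *)

theory Defs
  imports "Jordan_Normal_Form.DL_Rank" "Jordan_Normal_Form.Char_Poly" Complex_Main
begin

definition is_trajectory ::
  "real mat \<Rightarrow> real mat \<Rightarrow> nat \<Rightarrow> (nat \<Rightarrow> real vec) \<Rightarrow> (nat \<Rightarrow> real vec) \<Rightarrow> bool" where
  "is_trajectory A B T u x \<longleftrightarrow> (\<forall>k<T. x (Suc k) = A *\<^sub>v x k + B *\<^sub>v u k)"

text \<open>Controllability in the sense of the discrete-time system itself: every state can be steered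
  to every other state in finite time.\<close>

definition controllable :: "nat \<Rightarrow> nat \<Rightarrow> real mat \<Rightarrow> real mat \<Rightarrow> bool" where
  "controllable n m A B \<longleftrightarrow>
     (\<forall>x0 \<in> carrier_vec n. \<forall>x1 \<in> carrier_vec n. \<exists>N v z.
        (\<forall>k<N. v k \<in> carrier_vec m) \<and> z 0 = x0 \<and> is_trajectory A B N v z \<and> z N = x1)"

text \<open>The number of columns is written \<open>T + 1 - L\<close> so that truncated subtraction yields no
  columns (rather than one) when \<open>L > T\<close>.\<close>

definition hankel_mat :: "nat \<Rightarrow> nat \<Rightarrow> nat \<Rightarrow> (nat \<Rightarrow> real vec) \<Rightarrow> real mat" where
  "hankel_mat q T L w = mat (q * L) (T + 1 - L) (\<lambda>(i, j). w (j + i div q) $ (i mod q))"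

definition persistently_exciting :: "nat \<Rightarrow> nat \<Rightarrow> nat \<Rightarrow> (nat \<Rightarrow> real vec) \<Rightarrow> bool" where
  "persistently_exciting q T L w \<longleftrightarrow> vec_space.rank (q * L) (hankel_mat q T L w) = q * L"

text \<open>\<open>data_mat d T w\<close> is \<open>[w(0) \<dots> w(T-1)]\<close> and \<open>shifted_data_mat d T w\<close>
  is \<open>[w(1) \<dots> w(T)]\<close>, with columns of length \<open>d\<close>.\<close>

definition data_mat :: "nat \<Rightarrow> nat \<Rightarrow> (nat \<Rightarrow> real vec) \<Rightarrow> real mat" where
  "data_mat d T w = mat_of_cols d (map w [0..<T])"

definition shifted_data_mat :: "nat \<Rightarrow> nat \<Rightarrow> (nat \<Rightarrow> real vec) \<Rightarrow> real mat" where
  "shifted_data_mat d T w = mat_of_cols d (map w [1..<Suc T])"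

text \<open>\<open>xt\<close> is a possible output of the poisoning algorithm: the choice of the solutions \<open>g k\<close> is
  left open, so in general several \<open>xt\<close> satisfy the predicate.\<close>

definition poisoned_trajectory ::
  "nat \<Rightarrow> nat \<Rightarrow> nat \<Rightarrow> (nat \<Rightarrow> real vec) \<Rightarrow> (nat \<Rightarrow> real vec) \<Rightarrow> real \<Rightarrow> (nat \<Rightarrow> real vec) \<Rightarrow> bool" where
  "poisoned_trajectory n m T u x \<delta> xt \<longleftrightarrow>
     (\<exists>\<Delta> g. \<Delta> 0 = 0\<^sub>v n \<and> xt 0 = x 0 \<and>
        (\<forall>k<T. g k \<in> carrier_vec T \<and>
               (data_mat n T x @\<^sub>r data_mat m T u) *\<^sub>v g k = \<Delta> k @\<^sub>v 0\<^sub>v m \<and>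
               \<Delta> (Suc k) = shifted_data_mat n T x *\<^sub>v g k + \<delta> \<cdot>\<^sub>v (x k + \<Delta> k) \<and>
               xt (Suc k) = x (Suc k) + \<Delta> (Suc k)))"

definition consistent_system ::
  "nat \<Rightarrow> nat \<Rightarrow> nat \<Rightarrow> (nat \<Rightarrow> real vec) \<Rightarrow> (nat \<Rightarrow> real vec) \<Rightarrow> real mat \<Rightarrow> real mat \<Rightarrow> bool" where
  "consistent_system n m T u x A B \<longleftrightarrow>
     A \<in> carrier_mat n n \<and> B \<in> carrier_mat n m \<and>
     shifted_data_mat n T x = A * data_mat n T x + B * data_mat m T u"

definition schur_stable :: "real mat \<Rightarrow> bool" where
  "schur_stable M \<longleftrightarrow> (\<forall>ev::complex. eigenvalue (map_mat complex_of_real M) ev \<longrightarrow> cmod ev < 1)"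

end

theory Submission
  imports Defs "Jordan_Normal_Form.Spectral_Radius"
begin

text \<open>Since \<open>X\<^sub>+ = A X\<^sub>- + B U\<close>, each \<open>g(k)\<close> gives \<open>X\<^sub>+ g(k) = A \<Delta>(k)\<close>, so the poisoned states
  form a trajectory of \<open>(A + \<delta> I, B)\<close> for the same inputs. By Willems' fundamental lemma the
  poisoned state-input data have full row rank, so \<open>(A + \<delta> I, B)\<close> is the only system consistent
  with them. The closed loops \<open>A + B K\<close> and \<open>A + B K + \<delta> I\<close> have spectra that differ by the shift
  \<open>\<delta>\<close>, so they cannot both lie in the open unit disc when \<open>\<bar>\<delta>\<bar> \<ge> 2\<close>.

  In the rank argument, a left annihilator \<open>(\<xi>, \<eta>)\<close> of the data is propagated along \<open>0, \<dots>, n\<close> steps;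
  a linear dependence among the rows \<open>\<xi>\<^sup>T F\<^sup>j\<close>, where \<open>F = A + \<delta> I\<close>, eliminates the state, and
  persistency of excitation then annihilates \<open>\<eta>\<close> and all \<open>\<xi>\<^sup>T F\<^sup>j B\<close>.\<close>

section \<open>Linear algebra: left kernels, persistency of excitation, linear dependence\<close>

lemma real_scalar_prod_self_eq_0D:
  fixes v :: "real vec"
  assumes "v \<in> carrier_vec n" and "v \<bullet> v = 0"
  shows "v = 0\<^sub>v n"
  using assms by (auto simp: scalar_prod_def sum_nonneg_eq_0_iff)

lemma orthogonal_to_all_imp_zero:
  fixes v :: "real vec"
  assumes "v \<in> carrier_vec n" and "\<And>w. w \<in> carrier_vec n \<Longrightarrow> v \<bullet> w = 0"
  shows "v = 0\<^sub>v n"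
  using assms real_scalar_prod_self_eq_0D by blast

text \<open>Writing \<open>l = i * q + p\<close> with \<open>p < q\<close> splits a row index of the
  Hankel matrix into a time offset \<open>i\<close> and a component \<open>p\<close>.\<close>

lemma sum_lessThan_mult_div_mod:
  fixes h :: "nat \<Rightarrow> nat \<Rightarrow> 'a :: comm_monoid_add"
  shows "(\<Sum>l<q * L. h (l div q) (l mod q)) = (\<Sum>i<L. \<Sum>p<q. h i p)"
proof -
  have "(\<Sum>l<q * L. h (l div q) (l mod q))
      = (\<Sum>i<L. \<Sum>l\<in>{i * q..<i * q + q}. h (l div q) (l mod q))"
    by (simp add: sum.nat_group mult.commute)
  also have "\<dots> = (\<Sum>i<L. \<Sum>p<q. h i p)"
  proof (rule sum.cong[OF refl])
    fix i
    have "(\<Sum>l\<in>{i * q..<i * q + q}. h (l div q) (l mod q))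
        = (\<Sum>p\<in>{0..<q}. h ((p + i * q) div q) ((p + i * q) mod q))"
      using sum.shift_bounds_nat_ivl[of "\<lambda>l. h (l div q) (l mod q)" 0 "i * q" q]
      by (simp add: add.commute)
    also have "\<dots> = (\<Sum>p<q. h i p)"
      unfolding lessThan_atLeast0 by (rule sum.cong) simp_all
    finally show "(\<Sum>l\<in>{i * q..<i * q + q}. h (l div q) (l mod q)) = (\<Sum>p<q. h i p)" .
  qed
  finally show ?thesis .
qed

text \<open>With rank \<open>n\<close>, some \<open>n\<close> columns form a basis, so
  \<open>y\<close> lies in a span to which it is also orthogonal; hence
  \<open>y \<bullet> y = 0\<close>.\<close>

lemma full_row_rank_imp_left_kernel_trivial:
  fixes H :: "real mat"
  assumes H: "H \<in> carrier_mat n nc" and rank: "vec_space.rank n H = n"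
    and y: "y \<in> carrier_vec n" and orth: "\<And>j. j < nc \<Longrightarrow> y \<bullet> col H j = 0"
  shows "y = 0\<^sub>v n"
proof -
  interpret vec_space "TYPE(real)" n .
  have carr: "set (cols H) \<subseteq> carrier_vec n" using cols_dim H by blast
  \<comment> \<open>A maximal independent set of columns, grown from the empty set; its cardinality
    is the rank.\<close>
  obtain S where S: "finite S" "maximal S (\<lambda>T. T \<subseteq> set (cols H) \<and> lin_indpt T)"
    using maximal_exists_superset[of "set (cols H)" "\<lambda>T. T \<subseteq> set (cols H) \<and> lin_indpt T" "{}"]
    by (auto simp: lin_dep_def)
  then have sub: "S \<subseteq> set (cols H)" and li: "lin_indpt S" by (auto simp: maximal_def)
  have "card S = n" using rank_card_indpt[OF H S(2)] rank by simp
  then have "basis S" using dim_li_is_basis[OF fin_dim S(1) _ li] sub carr dim_is_n by auto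
  then have "y \<in> span S" using y by (auto simp: basis_def)
  moreover have "y \<in> orthogonal_complement (span S)"
  proof -
    have "y \<bullet> w = 0" if "w \<in> S" for w
    proof -
      from that sub have "w \<in> set (cols H)" by blast
      then obtain j where "j < nc" "w = col H j" using H by (auto simp: cols_def)
      then show ?thesis using orth by simp
    qed
    then show ?thesis
      using in_orthogonal_complement_span[of S] sub carr y
      by (auto simp: orthogonal_complement_def)
  qed
  ultimately have "y \<bullet> y = 0" by (auto simp: orthogonal_complement_def)
  then show ?thesis using y by (rule real_scalar_prod_self_eq_0D[rotated])
qed

text \<open>The form in which excitation is used: the vectors \<open>d i\<close>, stacked in the
  order of the Hankel rows, give a vector of the left kernel.\<close>

lemma persistently_exciting_imp_zero:
  assumes pe: "persistently_exciting q T L w"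
    and w: "\<And>k. k < T \<Longrightarrow> w k \<in> carrier_vec q"
    and d: "\<And>i. i < L \<Longrightarrow> d i \<in> carrier_vec q"
    and ann: "\<And>k. k < T + 1 - L \<Longrightarrow> (\<Sum>i<L. d i \<bullet> w (k + i)) = 0"
    and "i < L"
  shows "d i = 0\<^sub>v q"
proof -
  let ?H = "hankel_mat q T L w"
  define y where "y = vec (q * L) (\<lambda>l. d (l div q) $ (l mod q))"
  have H: "?H \<in> carrier_mat (q * L) (T + 1 - L)" by (simp add: hankel_mat_def)
  have "y \<bullet> col ?H k = 0" if k: "k < T + 1 - L" for k
  proof -
    have "y \<bullet> col ?H k = (\<Sum>l<q * L. d (l div q) $ (l mod q) * w (k + l div q) $ (l mod q))"
      using k by (auto simp: y_def scalar_prod_def hankel_mat_def lessThan_atLeast0 intro!: sum.cong)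
    also have "\<dots> = (\<Sum>i<L. \<Sum>p<q. d i $ p * w (k + i) $ p)"
      by (rule sum_lessThan_mult_div_mod)
    also have "\<dots> = (\<Sum>i<L. d i \<bullet> w (k + i))"
    proof (intro sum.cong refl)
      fix i assume "i \<in> {..<L}"
      then have "w (k + i) \<in> carrier_vec q" using k by (intro w) auto
      then show "(\<Sum>p<q. d i $ p * w (k + i) $ p) = d i \<bullet> w (k + i)"
        by (simp add: scalar_prod_def lessThan_atLeast0)
    qed
    finally show ?thesis using ann[OF k] by simp
  qed
  then have y0: "y = 0\<^sub>v (q * L)"
    using pe H
    by (intro full_row_rank_imp_left_kernel_trivial[of ?H _ "T + 1 - L"])
       (auto simp: persistently_exciting_def y_def)
  show ?thesis
  proof
    fix p assume "p < dim_vec (0\<^sub>v q :: real vec)"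
    then have p: "p < q" by simp
    have "i * q + p < q * L"
    proof -
      have "i * q + p < (i + 1) * q" using p by simp
      also have "\<dots> \<le> L * q" using \<open>i < L\<close> by (intro mult_right_mono) auto
      finally show ?thesis by (simp add: mult.commute)
    qed
    then show "d i $ p = 0\<^sub>v q $ p" using arg_cong[OF y0, of "\<lambda>v. v $ (i * q + p)"] p
      by (simp add: y_def)
  qed (use d \<open>i < L\<close> in auto)
qed

text \<open>Any \<open>n + 1\<close> vectors of dimension \<open>n\<close> are dependent.
  \<open>J\<close> is the last index with nonzero coefficient, so the relation can be solved for its
  top term, as the later triangular eliminations require.\<close>

lemma linear_dependence_with_leading_coeff:
  fixes r :: "nat \<Rightarrow> real vec"
  assumes r: "\<And>i. r i \<in> carrier_vec n"
  obtains c J where "J \<le> n" and "c J \<noteq> 0"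
    and "\<And>v. v \<in> carrier_vec n \<Longrightarrow> (\<Sum>j\<le>J. c j * (r j \<bullet> v)) = 0"
proof -
  \<comment> \<open>The vectors \<open>r 0\<close>, ..., \<open>r n\<close> as columns, padded with
    a zero row: a square singular matrix, so a kernel vector comes from the determinant.\<close>
  define M where "M = mat (Suc n) (Suc n) (\<lambda>(i, j). if i < n then r j $ i else 0)"
  have M: "M \<in> carrier_mat (Suc n) (Suc n)" by (simp add: M_def)
  have "transpose_mat M *\<^sub>v unit_vec (Suc n) n = 0\<^sub>v (Suc n)"
    by (rule eq_vecI) (auto simp: M_def)
  then have "det (transpose_mat M) = 0"
    using M by (subst det_0_iff_vec_prod_zero[where n = "Suc n"])
      (auto intro!: exI[of _ "unit_vec (Suc n) n"])
  then have "det M = 0" using det_transpose[OF M] by simp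
  then obtain a where a: "a \<in> carrier_vec (Suc n)" "a \<noteq> 0\<^sub>v (Suc n)" "M *\<^sub>v a = 0\<^sub>v (Suc n)"
    using det_0_iff_vec_prod_zero[OF M] by auto
  have nz: "\<exists>j\<le>n. a $ j \<noteq> 0"
  proof (rule ccontr)
    assume "\<not> ?thesis"
    then have "a = 0\<^sub>v (Suc n)" using a(1) by (intro eq_vecI) (auto simp: less_Suc_eq_le)
    then show False using a(2) by simp
  qed
  define Z where "Z = {j. j \<le> n \<and> a $ j \<noteq> 0}"
  have Z: "finite Z" "Z \<noteq> {}" using nz by (auto simp: Z_def)
  define J where "J = Max Z"
  have "J \<in> Z" using Z unfolding J_def by (rule Max_in)
  then have J: "J \<le> n" "a $ J \<noteq> 0" by (auto simp: Z_def)
  have top: "a $ j = 0" if "j \<le> n" "j > J" for j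
    using that Max_ge[OF Z(1), of j] by (fastforce simp: Z_def J_def)
  have comp: "(\<Sum>j\<le>J. a $ j * r j $ i) = 0" if i: "i < n" for i
  proof -
    have "0 = (M *\<^sub>v a) $ i" using a(3) i by simp
    also have "\<dots> = (\<Sum>j\<le>n. a $ j * r j $ i)"
      using i a(1) by (auto simp: M_def scalar_prod_def atLeast0LessThan lessThan_Suc_atMost mult.commute
          intro!: sum.cong)
    also have "\<dots> = (\<Sum>j\<le>J. a $ j * r j $ i)"
      using J top by (intro sum.mono_neutral_right) auto
    finally show ?thesis by simp
  qed
  have "(\<Sum>j\<le>J. a $ j * (r j \<bullet> v)) = 0" if v: "v \<in> carrier_vec n" for v
  proof -
    have "(\<Sum>j\<le>J. a $ j * (r j \<bullet> v)) = (\<Sum>i<n. (\<Sum>j\<le>J. a $ j * r j $ i) * v $ i)"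
      using v by (simp add: scalar_prod_def atLeast0LessThan sum_distrib_left sum_distrib_right
          mult.assoc sum.swap[of _ "{..J}"])
    then show ?thesis by (simp add: comp)
  qed
  then show ?thesis using that[of J "\<lambda>j. a $ j"] J by blast
qed

lemma smult_one_mat_mult_vec:
  fixes v :: "'a :: comm_ring_1 vec"
  assumes "v \<in> carrier_vec n"
  shows "(c \<cdot>\<^sub>m 1\<^sub>m n) *\<^sub>v v = c \<cdot>\<^sub>v v"
  using assms by (intro eq_vecI) auto

section \<open>Data matrices and the dynamics of the poisoned trajectory\<close>

lemma consistent_system_iff_is_trajectory:
  assumes A: "A \<in> carrier_mat n n" and B: "B \<in> carrier_mat n m"
    and u: "\<And>k. k < T \<Longrightarrow> u k \<in> carrier_vec m"
    and x: "\<And>k. k \<le> T \<Longrightarrow> x k \<in> carrier_vec n"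
  shows "consistent_system n m T u x A B \<longleftrightarrow> is_trajectory A B T u x"
proof -
  let ?X = "data_mat n T x" and ?U = "data_mat m T u" and ?Xp = "shifted_data_mat n T x"
  have carr: "?X \<in> carrier_mat n T" "?U \<in> carrier_mat m T" "?Xp \<in> carrier_mat n T"
    by (auto simp: data_mat_def shifted_data_mat_def simp del: upt_Suc)
  have cols: "col ?X k = x k" "col ?U k = u k" "col ?Xp k = x (Suc k)" if "k < T" for k
    using that x[of k] x[of "Suc k"] u[of k]
    by (auto simp: data_mat_def shifted_data_mat_def simp del: upt_Suc)
  have rhs: "col (A * ?X + B * ?U) k = A *\<^sub>v x k + B *\<^sub>v u k" if k: "k < T" for k
  proof -
    have "col (A * ?X + B * ?U) k = col (A * ?X) k + col (B * ?U) k"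
      using A B carr k by (intro eq_vecI) auto
    then show ?thesis
      using cols[OF k] col_mult2[OF A carr(1) k] col_mult2[OF B carr(2) k] by simp
  qed
  have "?Xp = A * ?X + B * ?U \<longleftrightarrow> (\<forall>k<T. col ?Xp k = col (A * ?X + B * ?U) k)"
    using A B carr by (auto intro!: mat_col_eqI)
  then show ?thesis
    using A B by (simp add: consistent_system_def is_trajectory_def cols rhs)
qed

text \<open>Because \<open>X\<^sub>+ = A X\<^sub>- + B U\<close>, the product
  \<open>X\<^sub>+ g(k)\<close> depends on \<open>g(k)\<close> only through the two prescribed
  products, so the choice of solution does not matter.\<close>

lemma poisoned_trajectory_is_trajectory:
  assumes A: "A \<in> carrier_mat n n" and B: "B \<in> carrier_mat n m"
    and u: "\<And>k. k < T \<Longrightarrow> u k \<in> carrier_vec m"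
    and x: "\<And>k. k \<le> T \<Longrightarrow> x k \<in> carrier_vec n"
    and traj: "is_trajectory A B T u x"
    and pois: "poisoned_trajectory n m T u x \<delta> xt"
  shows "is_trajectory (A + \<delta> \<cdot>\<^sub>m 1\<^sub>m n) B T u xt" and "\<And>k. k \<le> T \<Longrightarrow> xt k \<in> carrier_vec n"
proof -
  let ?X = "data_mat n T x" and ?U = "data_mat m T u" and ?Xp = "shifted_data_mat n T x"
  have X: "?X \<in> carrier_mat n T" and U: "?U \<in> carrier_mat m T"
    and Xpc: "?Xp \<in> carrier_mat n T"
    by (auto simp: data_mat_def shifted_data_mat_def simp del: upt_Suc)
  have Xp: "?Xp = A * ?X + B * ?U"
    using consistent_system_iff_is_trajectory[OF A B, of T u x] u x traj
    by (simp add: consistent_system_def)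
  obtain \<Delta> g where \<Delta>0: "\<Delta> 0 = 0\<^sub>v n" and xt0: "xt 0 = x 0"
    and g: "\<And>k. k < T \<Longrightarrow> g k \<in> carrier_vec T"
    and sol: "\<And>k. k < T \<Longrightarrow> (?X @\<^sub>r ?U) *\<^sub>v g k = \<Delta> k @\<^sub>v 0\<^sub>v m"
    and \<Delta>Suc: "\<And>k. k < T \<Longrightarrow> \<Delta> (Suc k) = ?Xp *\<^sub>v g k + \<delta> \<cdot>\<^sub>v (x k + \<Delta> k)"
    and xtSuc: "\<And>k. k < T \<Longrightarrow> xt (Suc k) = x (Suc k) + \<Delta> (Suc k)"
    using pois unfolding poisoned_trajectory_def by blast
  have \<Delta>: "\<Delta> k \<in> carrier_vec n" if "k \<le> T" for k
    using that
  proof (induction k)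
    case (Suc k)
    then have "\<Delta> k \<in> carrier_vec n" "x k \<in> carrier_vec n" using x by auto
    moreover have "?Xp *\<^sub>v g k \<in> carrier_vec n"
      using Suc.prems Xpc g[of k] by (intro mult_mat_vec_carrier) auto
    ultimately show ?case using Suc.prems \<Delta>Suc[of k] by simp
  qed (simp add: \<Delta>0)
  have xt: "xt k = x k + \<Delta> k" if "k \<le> T" for k
    using that \<Delta>0 xt0 xtSuc x[of 0] by (cases k) auto
  show xt_carrier: "xt k \<in> carrier_vec n" if "k \<le> T" for k
    using xt[OF that] \<Delta>[OF that] x[OF that] by simp
  have step: "xt (Suc k) = (A + \<delta> \<cdot>\<^sub>m 1\<^sub>m n) *\<^sub>v xt k + B *\<^sub>v u k" if k: "k < T" for k
  proof -
    note c = x[of k] \<Delta>[of k] u[OF k] xt_carrier[of k]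
    have "(?X *\<^sub>v g k) @\<^sub>v (?U *\<^sub>v g k) = \<Delta> k @\<^sub>v 0\<^sub>v m"
      using mat_mult_append[OF X U g[OF k]] sol[OF k] by simp
    then have sol': "?X *\<^sub>v g k = \<Delta> k" "?U *\<^sub>v g k = 0\<^sub>v m"
      using append_vec_eq[OF mult_mat_vec_carrier[OF X g[OF k]] \<Delta>[of k]] k by auto
    have "?Xp *\<^sub>v g k = A *\<^sub>v (?X *\<^sub>v g k) + B *\<^sub>v (?U *\<^sub>v g k)"
      unfolding Xp using A B X U g[OF k]
      by (simp add: add_mult_distrib_mat_vec[where nr = n and nc = T]
          assoc_mult_mat_vec[where n\<^sub>1 = n and n\<^sub>3 = T])
    moreover have "B *\<^sub>v 0\<^sub>v m = 0\<^sub>v n" using B by (intro eq_vecI) auto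
    ultimately have Xpg: "?Xp *\<^sub>v g k = A *\<^sub>v \<Delta> k" using sol' A \<Delta>[of k] k by simp
    have F: "(A + \<delta> \<cdot>\<^sub>m 1\<^sub>m n) *\<^sub>v xt k = A *\<^sub>v x k + A *\<^sub>v \<Delta> k + \<delta> \<cdot>\<^sub>v xt k"
    proof -
      have "(A + \<delta> \<cdot>\<^sub>m 1\<^sub>m n) *\<^sub>v xt k = A *\<^sub>v xt k + \<delta> \<cdot>\<^sub>v xt k"
        using A c k
        by (simp add: add_mult_distrib_mat_vec[where nr = n and nc = n] smult_one_mat_mult_vec)
      moreover have "A *\<^sub>v xt k = A *\<^sub>v x k + A *\<^sub>v \<Delta> k"
        using A c k xt[of k] by (simp add: mult_add_distrib_mat_vec[where nr = n and nc = n])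
      ultimately show ?thesis by simp
    qed
    have "xt (Suc k) = (A *\<^sub>v x k + B *\<^sub>v u k) + (A *\<^sub>v \<Delta> k + \<delta> \<cdot>\<^sub>v xt k)"
      using traj k xtSuc[OF k] \<Delta>Suc[OF k] Xpg xt[of k] by (simp add: is_trajectory_def)
    also have "\<dots> = (A *\<^sub>v x k + A *\<^sub>v \<Delta> k + \<delta> \<cdot>\<^sub>v xt k) + B *\<^sub>v u k"
      using A B c k by (intro eq_vecI) auto
    finally show ?thesis unfolding F .
  qed
  then show "is_trajectory (A + \<delta> \<cdot>\<^sub>m 1\<^sub>m n) B T u xt" by (simp add: is_trajectory_def)
qed

section \<open>Willems' fundamental lemma for the shifted system\<close>

text \<open>Here \<open>r i\<close> plays the role of the row vector \<open>\<xi>\<^sup>T (A + c I)\<^sup>i\<close>. Working with the whole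
  family avoids transferring controllability from \<open>(A, B)\<close> to \<open>(A + c I, B)\<close>.\<close>

lemma controllable_shift_left_annihilator:
  assumes A: "A \<in> carrier_mat n n" and B: "B \<in> carrier_mat n m"
    and ctrl: "controllable n m A B"
    and r: "\<And>i. r i \<in> carrier_vec n"
    and rA: "\<And>i v. v \<in> carrier_vec n \<Longrightarrow> r i \<bullet> (A *\<^sub>v v) = r (Suc i) \<bullet> v - c * (r i \<bullet> v)"
    and rB: "\<And>i v. v \<in> carrier_vec m \<Longrightarrow> r i \<bullet> (B *\<^sub>v v) = 0"
  shows "r 0 = 0\<^sub>v n"
proof -
  obtain N v z where v: "\<And>k. k < N \<Longrightarrow> v k \<in> carrier_vec m" and z0: "z 0 = 0\<^sub>v n"
    and z: "is_trajectory A B N v z" and zN: "z N = r 0"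
    using ctrl r[of 0] unfolding controllable_def by (meson zero_carrier_vec)
  \<comment> \<open>Every state reached from the origin is orthogonal to the whole family
    \<open>r\<close>. The target was chosen to be \<open>r 0\<close>, which is therefore orthogonal
    to itself.\<close>
  have "z k \<in> carrier_vec n \<and> (\<forall>i. r i \<bullet> z k = 0)" if "k \<le> N" for k
    using that
  proof (induction k)
    case 0
    then show ?case using r by (simp add: z0)
  next
    case (Suc k)
    then have zk: "z k \<in> carrier_vec n" "\<And>i. r i \<bullet> z k = 0" and vk: "v k \<in> carrier_vec m"
      using v by auto
    have step: "z (Suc k) = A *\<^sub>v z k + B *\<^sub>v v k"
      using z Suc.prems by (simp add: is_trajectory_def)
    have "r i \<bullet> z (Suc k) = 0" for i
      using A B zk vk r[of i] rA[OF zk(1), of i] rB[OF vk, of i]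
      by (simp add: step scalar_prod_add_distrib[where n = n])
    then show ?case using A B zk vk by (simp add: step)
  qed
  from this[of N] show ?thesis using zN r[of 0] real_scalar_prod_self_eq_0D by auto
qed

text \<open>The dual form of full row rank of the stacked state-input data. The data come from
  \<open>A + c I\<close>, whereas controllability is assumed of \<open>(A, B)\<close>
  itself.\<close>

lemma state_input_data_left_kernel_trivial:
  fixes \<xi> \<eta> :: "real vec"
  assumes A: "A \<in> carrier_mat n n" and B: "B \<in> carrier_mat n m"
    and ctrl: "controllable n m A B"
    and u: "\<And>k. k < T \<Longrightarrow> u k \<in> carrier_vec m"
    and x: "\<And>k. k \<le> T \<Longrightarrow> x k \<in> carrier_vec n"
    and traj: "is_trajectory (A + c \<cdot>\<^sub>m 1\<^sub>m n) B T u x"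
    and pe: "persistently_exciting m T (n + 1) u"
    and \<xi>: "\<xi> \<in> carrier_vec n" and \<eta>: "\<eta> \<in> carrier_vec m"
    and ann: "\<And>k. k < T \<Longrightarrow> \<xi> \<bullet> x k + \<eta> \<bullet> u k = 0"
  shows "\<xi> = 0\<^sub>v n \<and> \<eta> = 0\<^sub>v m"
proof -
  define F where "F = A + c \<cdot>\<^sub>m 1\<^sub>m n"
  have F: "F \<in> carrier_mat n n" using A by (simp add: F_def)
  define r where "r i = ((\<lambda>v. transpose_mat F *\<^sub>v v) ^^ i) \<xi>" for i
  \<comment> \<open>\<open>s l\<close> is the coefficient of the input that lies \<open>l\<close>
    steps before the time of annihilation: \<open>\<eta>\<close> acts at that time itself, and an
    older input enters through \<open>B\<close> and \<open>l - 1\<close> powers of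
    \<open>F\<close>.\<close>
  define s where "s l = (case l of 0 \<Rightarrow> \<eta> | Suc i \<Rightarrow> transpose_mat B *\<^sub>v r i)" for l
  have r0: "r 0 = \<xi>" and rSuc: "r (Suc i) = transpose_mat F *\<^sub>v r i" for i
    by (simp_all add: r_def)
  have r: "r i \<in> carrier_vec n" for i
    by (induction i) (use \<xi> F in \<open>auto simp: r0 rSuc\<close>)
  have s: "s l \<in> carrier_vec m" for l
    using \<eta> B r by (auto simp: s_def split: nat.split)
  have rF: "r i \<bullet> (F *\<^sub>v v) = r (Suc i) \<bullet> v" if "v \<in> carrier_vec n" for i v
    unfolding rSuc using transpose_vec_mult_scalar[OF F that r] by simp
  have rB: "r i \<bullet> (B *\<^sub>v v) = s (Suc i) \<bullet> v" if "v \<in> carrier_vec m" for i v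
    using transpose_vec_mult_scalar[OF B that r] by (simp add: s_def)

  \<comment> \<open>The annihilation at time \<open>k + j\<close>, with \<open>x (k + j)\<close>
    unrolled back to \<open>x k\<close>.\<close>
  have window: "r j \<bullet> x k + (\<Sum>i\<le>j. s (j - i) \<bullet> u (k + i)) = 0" if "k + j < T" for j k
    using that
  proof (induction j arbitrary: k)
    case 0
    then show ?case using ann[of k] by (simp add: r0 s_def)
  next
    case (Suc j)
    then have c: "x k \<in> carrier_vec n" "u k \<in> carrier_vec m" using x u by auto
    have "x (Suc k) = F *\<^sub>v x k + B *\<^sub>v u k"
      using traj Suc.prems by (simp add: is_trajectory_def F_def)
    then have "r j \<bullet> x (Suc k) = r (Suc j) \<bullet> x k + s (Suc j) \<bullet> u k"
      using F B c r[of j] rF[OF c(1), of j] rB[OF c(2), of j]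
      by (simp add: scalar_prod_add_distrib[where n = n])
    with Suc.IH[of "Suc k"] Suc.prems show ?case
      by (simp add: sum.atMost_Suc_shift del: sum.atMost_Suc)
  qed

  obtain a J where J: "J \<le> n" "a J \<noteq> 0"
    and dep: "\<And>v. v \<in> carrier_vec n \<Longrightarrow> (\<Sum>j\<le>J. a j * (r j \<bullet> v)) = 0"
    using linear_dependence_with_leading_coeff[of r n] r by metis
  \<comment> \<open>\<open>d i\<close> is the coefficient of \<open>u (k + i)\<close> after the \<open>a\<close>-combination of the windows\<close>
  define d where "d i = vec m (\<lambda>p. \<Sum>j\<le>J. if i \<le> j then a j * s (j - i) $ p else 0)" for i
  have d_prod: "d i \<bullet> v = (\<Sum>j\<le>J. if i \<le> j then a j * (s (j - i) \<bullet> v) else 0)"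
    if "v \<in> carrier_vec m" for i v
  proof -
    have "d i \<bullet> v = (\<Sum>p<m. \<Sum>j\<le>J. (if i \<le> j then a j * s (j - i) $ p else 0) * v $ p)"
      using that by (auto simp: d_def scalar_prod_def lessThan_atLeast0 sum_distrib_right
          intro!: sum.cong)
    also have "\<dots> = (\<Sum>j\<le>J. \<Sum>p<m. (if i \<le> j then a j * s (j - i) $ p else 0) * v $ p)"
      by (rule sum.swap)
    also have "\<dots> = (\<Sum>j\<le>J. if i \<le> j then a j * (s (j - i) \<bullet> v) else 0)"
      using that by (intro sum.cong refl)
        (simp add: scalar_prod_def lessThan_atLeast0 sum_distrib_left mult.assoc)
    finally show ?thesis .
  qed
  \<comment> \<open>The combination with coefficients \<open>a\<close> cancels \<open>x k\<close>
    and leaves only inputs. The bound on \<open>k\<close> means \<open>k + n < T\<close>, so all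
    windows with \<open>j \<le> J\<close> fit; for \<open>J < i \<le> n\<close> the sum defining
    \<open>d i\<close> has only zero terms, which pads to depth \<open>n + 1\<close>.\<close>
  have d0: "d i = 0\<^sub>v m" if "i < n + 1" for i
  proof (rule persistently_exciting_imp_zero[OF pe u _ _ that])
    fix k assume k: "k < T + 1 - (n + 1)"
    have "(\<Sum>i<n + 1. d i \<bullet> u (k + i))
        = (\<Sum>i<n + 1. \<Sum>j\<le>J. if i \<le> j then a j * (s (j - i) \<bullet> u (k + i)) else 0)"
      using k by (intro sum.cong refl d_prod u) auto
    also have "\<dots> = (\<Sum>j\<le>J. \<Sum>i<n + 1. if i \<le> j then a j * (s (j - i) \<bullet> u (k + i)) else 0)"
      by (rule sum.swap)
    also have "\<dots> = (\<Sum>j\<le>J. - a j * (r j \<bullet> x k))"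
    proof (intro sum.cong refl)
      fix j assume "j \<in> {..J}"
      then have j: "j \<le> n" using J by simp
      have "(\<Sum>i<n + 1. if i \<le> j then a j * (s (j - i) \<bullet> u (k + i)) else 0)
          = (\<Sum>i\<le>j. a j * (s (j - i) \<bullet> u (k + i)))"
        using j by (intro sum.mono_neutral_cong_right) auto
      also have "\<dots> = a j * (\<Sum>i\<le>j. s (j - i) \<bullet> u (k + i))"
        by (simp add: sum_distrib_left)
      also have "(\<Sum>i\<le>j. s (j - i) \<bullet> u (k + i)) = - (r j \<bullet> x k)"
        using window[of k j] j k by (simp add: eq_neg_iff_add_eq_0 add.commute)
      finally show "(\<Sum>i<n + 1. if i \<le> j then a j * (s (j - i) \<bullet> u (k + i)) else 0)
          = - a j * (r j \<bullet> x k)" by simp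
    qed
    also have "\<dots> = 0" using dep[of "x k"] x[of k] k by (simp add: sum_negf)
    finally show "(\<Sum>i<n + 1. d i \<bullet> u (k + i)) = 0" .
  qed (auto simp: d_def)

  \<comment> \<open>A triangular system: in \<open>d (J - l)\<close> the term \<open>j = J\<close>
    is \<open>a J\<close> times \<open>s l\<close>, and the other terms contain only
    \<open>s\<close> at smaller indices.\<close>
  have s0: "s l = 0\<^sub>v m" if "l \<le> J" for l
    using that
  proof (induction l rule: less_induct)
    case (less l)
    have "s l \<bullet> v = 0" if v: "v \<in> carrier_vec m" for v
    proof -
      have "0 = d (J - l) \<bullet> v" using d0[of "J - l"] J v by simp
      also have "\<dots> = (\<Sum>j\<le>J. if j = J then a J * (s l \<bullet> v) else 0)"
        unfolding d_prod[OF v]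
      proof (intro sum.cong refl)
        fix j assume "j \<in> {..J}"
        moreover have "s (j - (J - l)) = 0\<^sub>v m" if "J - l \<le> j" "j < J"
          using that less by (intro less.IH) auto
        ultimately show "(if J - l \<le> j then a j * (s (j - (J - l)) \<bullet> v) else 0)
            = (if j = J then a J * (s l \<bullet> v) else 0)"
          using less.prems v by (cases "j = J") auto
      qed
      also have "\<dots> = a J * (s l \<bullet> v)" by simp
      finally show ?thesis using J by simp
    qed
    then show ?case using orthogonal_to_all_imp_zero[OF s] by blast
  qed

  \<comment> \<open>Replacing \<open>v\<close> by \<open>F *\<^sub>v v\<close> moves every index of
    \<open>r\<close> up by one, so the dependence becomes a linear recurrence of order
    \<open>J\<close>.\<close>
  have dep_shift: "(\<Sum>j\<le>J. a j * (r (j + i) \<bullet> v)) = 0" if "v \<in> carrier_vec n" for i v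
    using that
  proof (induction i arbitrary: v)
    case (Suc i)
    then show ?case using Suc.IH[of "F *\<^sub>v v"] F by (simp add: rF)
  qed (simp add: dep)
  \<comment> \<open>The recurrence, tested on the range of \<open>B\<close>, determines
    \<open>s (Suc i)\<close> from the \<open>J\<close> preceding values since
    \<open>a J \<noteq> 0\<close>; \<open>s0\<close> supplies the initial values.\<close>
  have sSuc0: "s (Suc i) \<bullet> v = 0" if v: "v \<in> carrier_vec m" for i v
  proof (induction i rule: less_induct)
    case (less i)
    show ?case
    proof (cases "i < J")
      case True
      then show ?thesis using s0[of "Suc i"] v by simp
    next
      case False
      have "0 = (\<Sum>j\<le>J. a j * (s (Suc (j + (i - J))) \<bullet> v))"
        using dep_shift[of "B *\<^sub>v v" "i - J"] B v by (simp add: rB)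
      also have "\<dots> = (\<Sum>j\<le>J. if j = J then a J * (s (Suc i) \<bullet> v) else 0)"
        using False less.IH by (intro sum.cong refl) auto
      also have "\<dots> = a J * (s (Suc i) \<bullet> v)" by simp
      finally show ?thesis using J by simp
    qed
  qed
  have "r 0 = 0\<^sub>v n"
  proof (rule controllable_shift_left_annihilator[OF A B ctrl r])
    fix i and v :: "real vec" assume v: "v \<in> carrier_vec n"
    have "r i \<bullet> (F *\<^sub>v v) = r i \<bullet> (A *\<^sub>v v) + c * (r i \<bullet> v)"
      using A v r[of i]
      by (simp add: F_def add_mult_distrib_mat_vec[where nr = n and nc = n]
          smult_one_mat_mult_vec scalar_prod_add_distrib[where n = n])
    then show "r i \<bullet> (A *\<^sub>v v) = r (Suc i) \<bullet> v - c * (r i \<bullet> v)" using rF[OF v, of i] by simp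
  qed (simp add: rB sSuc0)
  then show ?thesis using s0[of 0] by (simp add: r0 s_def)
qed

section \<open>Uniqueness of the consistent system\<close>

lemma consistent_system_unique:
  assumes A: "A \<in> carrier_mat n n" and B: "B \<in> carrier_mat n m"
    and ctrl: "controllable n m A B"
    and u: "\<And>k. k < T \<Longrightarrow> u k \<in> carrier_vec m"
    and x: "\<And>k. k \<le> T \<Longrightarrow> x k \<in> carrier_vec n"
    and traj: "is_trajectory (A + c \<cdot>\<^sub>m 1\<^sub>m n) B T u x"
    and pe: "persistently_exciting m T (n + 1) u"
    and cons: "consistent_system n m T u x At Bt"
  shows "At = A + c \<cdot>\<^sub>m 1\<^sub>m n" and "Bt = B"
proof -
  define F where "F = A + c \<cdot>\<^sub>m 1\<^sub>m n"
  have F: "F \<in> carrier_mat n n" using A by (simp add: F_def)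
  have At: "At \<in> carrier_mat n n" and Bt: "Bt \<in> carrier_mat n m"
    using cons by (auto simp: consistent_system_def)
  have trajt: "is_trajectory At Bt T u x"
    using consistent_system_iff_is_trajectory[OF At Bt u x] cons by simp
  \<comment> \<open>Both systems reproduce the same successor states, so the row differences of the
    two matrix pairs form a left annihilator of the data.\<close>
  have zero: "row At l - row F l = 0\<^sub>v n \<and> row Bt l - row B l = 0\<^sub>v m" if l: "l < n" for l
  proof (rule state_input_data_left_kernel_trivial[OF A B ctrl u x traj pe])
    fix k assume k: "k < T"
    note c = x[of k] u[OF k]
    have "(At *\<^sub>v x k + Bt *\<^sub>v u k) $ l = (F *\<^sub>v x k + B *\<^sub>v u k) $ l"
      using traj trajt k by (simp add: is_trajectory_def F_def)
    then have "row At l \<bullet> x k + row Bt l \<bullet> u k = row F l \<bullet> x k + row B l \<bullet> u k"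
      using l At Bt F B by simp
    moreover have "row At l \<in> carrier_vec n" "row F l \<in> carrier_vec n"
        "row Bt l \<in> carrier_vec m" "row B l \<in> carrier_vec m"
      using l At Bt F B by auto
    ultimately show "(row At l - row F l) \<bullet> x k + (row Bt l - row B l) \<bullet> u k = 0"
      using minus_scalar_prod_distrib[of "row At l" n "row F l" "x k"]
        minus_scalar_prod_distrib[of "row Bt l" m "row B l" "u k"] c k by simp
  qed (use l At Bt F B in \<open>auto intro!: minus_carrier_vec\<close>)
  have ent: "At $$ (l, j) = F $$ (l, j)" if "l < n" "j < n" for l j
    using arg_cong[OF conjunct1[OF zero[OF that(1)]], of "\<lambda>v. v $ j"] that At F by simp
  have entB: "Bt $$ (l, j) = B $$ (l, j)" if "l < n" "j < m" for l j
    using arg_cong[OF conjunct2[OF zero[OF that(1)]], of "\<lambda>v. v $ j"] that Bt B by simp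
  show "At = A + c \<cdot>\<^sub>m 1\<^sub>m n" using At F ent unfolding F_def[symmetric] by (intro eq_matI) auto
  show "Bt = B" using Bt B entB by (intro eq_matI) auto
qed

section \<open>Spectral shift and destabilization\<close>

text \<open>A complex matrix of positive size has an eigenvalue \<open>e\<close>, and its
  eigenvector gives the eigenvalue \<open>e + c\<close> of the shifted matrix. Two points of the
  open unit disc are less than 2 apart.\<close>

lemma schur_stable_shift_bound:
  assumes M: "M \<in> carrier_mat n n" and "n \<ge> 1"
    and st: "schur_stable M" and st': "schur_stable (M + c \<cdot>\<^sub>m 1\<^sub>m n)"
  shows "\<bar>c\<bar> < 2"
proof -
  let ?h = "map_mat complex_of_real"
  have hM: "?h M \<in> carrier_mat n n" using M by simp
  obtain e where e: "eigenvalue (?h M) e"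
    using spectrum_non_empty[OF hM] \<open>n \<ge> 1\<close> by (auto simp: spectrum_def)
  then obtain v where v: "v \<in> carrier_vec n" "v \<noteq> 0\<^sub>v n" "?h M *\<^sub>v v = e \<cdot>\<^sub>v v"
    using hM by (auto simp: eigenvalue_def eigenvector_def)
  have "?h (M + c \<cdot>\<^sub>m 1\<^sub>m n) = ?h M + complex_of_real c \<cdot>\<^sub>m 1\<^sub>m n"
    using M by (intro eq_matI) auto
  then have "?h (M + c \<cdot>\<^sub>m 1\<^sub>m n) *\<^sub>v v = (e + complex_of_real c) \<cdot>\<^sub>v v"
    using hM v by (simp add: add_mult_distrib_mat_vec[where nr = n and nc = n]
        smult_one_mat_mult_vec add_smult_distrib_vec)
  then have "eigenvalue (?h (M + c \<cdot>\<^sub>m 1\<^sub>m n)) (e + complex_of_real c)"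
    using v M by (auto simp: eigenvalue_def eigenvector_def)
  then have "cmod (e + complex_of_real c) < 1" "cmod e < 1"
    using st st' e by (auto simp: schur_stable_def)
  moreover have "\<bar>c\<bar> \<le> cmod (e + complex_of_real c) + cmod e"
    using norm_triangle_ineq4[of "e + complex_of_real c" e] by simp
  ultimately show ?thesis by simp
qed

theorem theorem2:
  fixes n m T :: nat
    and A B :: "real mat"
    and u x xt :: "nat \<Rightarrow> real vec"
    and \<delta> :: real
  assumes "n \<ge> 1" and "m \<ge> 1" and "T \<ge> 1"
    and "A \<in> carrier_mat n n" and "B \<in> carrier_mat n m"
    and "controllable n m A B"
    and "\<And>k. k < T \<Longrightarrow> u k \<in> carrier_vec m"
    and "\<And>k. k \<le> T \<Longrightarrow> x k \<in> carrier_vec n"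
    and "is_trajectory A B T u x"
    and "persistently_exciting m T (n + 1) u"
    and "\<bar>\<delta>\<bar> \<ge> 2"
    and "poisoned_trajectory n m T u x \<delta> xt"
  shows "\<forall>K \<in> carrier_mat m n. \<forall>At Bt.
           consistent_system n m T u xt At Bt \<and> schur_stable (At + Bt * K) \<longrightarrow>
           \<not> schur_stable (A + B * K)"
proof (intro ballI allI impI notI)
  fix K At Bt
  assume K: "K \<in> carrier_mat m n"
    and h: "consistent_system n m T u xt At Bt \<and> schur_stable (At + Bt * K)"
    and st: "schur_stable (A + B * K)"
  note xt = poisoned_trajectory_is_trajectory[OF assms(4,5,7,8,9,12)]
  have eq: "At = A + \<delta> \<cdot>\<^sub>m 1\<^sub>m n" "Bt = B"
    using consistent_system_unique[OF assms(4,5,6,7) xt(2,1) assms(10)] h by auto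
  \<comment> \<open>As the input matrix is unchanged by the attack, the feedback term is common to
    both closed loops and only the shift remains.\<close>
  have "At + Bt * K = (A + B * K) + \<delta> \<cdot>\<^sub>m 1\<^sub>m n"
    unfolding eq using assms(4,5) K by (intro eq_matI) auto
  then have "\<bar>\<delta>\<bar> < 2"
    using schur_stable_shift_bound[of "A + B * K" n \<delta>] assms(1,4,5) K st h by auto
  then show False using assms(11) by simp
qed

end
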